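(* Let $\rho_\varepsilon(x-y)=\mathbf{1}_{[0,\varepsilon]}(|x-y|)\,|x-y|^{-(d+\alpha-1)}$, let $g\in L^{d/\alpha}(\mathbb{R}^d)$, let $$E\in\operatorname*{arg\,min}_F\ \mathbb{P}_\varepsilon(F)+\int_F g(x)\,dx,$$ and let $\{E^{x_i}\}_{i\in I}$ be the $\varepsilon$-connected components of $E$. Then there is a constant $c(\alpha,d,g)>0$ such that $$|E^{x_i}|>c(\alpha,d,g)\qquad\text{for all } i\in I.$$
   Context: Here $\alpha\in(0,1)$, $\varepsilon>0$, $|\cdot|$ applied to a set denotes Lebesgue measure, and $F$ ranges over measurable subsets of $\mathbb{R}^d$. For measurable $F\subset\mathbb{R}^d$, $$\mathbb{P}_\varepsilon(F):=\int_{\mathbb{R}^d}\int_{\mathbb{R}^d}\frac{|\mathbf{1}_F(x)-\mathbf{1}_F(y)|}{|x-y|}\rho_\varepsilon(x-y)\,dx\,dy=2\int_F\int_{F^c}\frac{1}{|x-y|}\rho_\varepsilon(x-y)\,dx\,dy .$$ $E^{(1)}:=\{x\in\mathbb{R}^d:\lim_{r\to0}|E\cap B_r(x)|/|B_r(x)|=1\}$. Points $x,y\in E^{(1)}$ are $\varepsilon$-connected in $E$ if there are $z_0,\dots,z_N\in E^{(1)}$ with $z_0=x$, $z_N=y$ and $|z_i-z_{i+1}|<\varepsilon$ for all $i=0,\dots,N-1$. For $x\in E^{(1)}$, the $\varepsilon$-connected component of $E$ containing $x$ is $E^x:=\{y\in E^{(1)}: y\text{ is }\varepsilon\text{-connected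 to }x\text{ in }E\}$. For a set $E$ with $\mathbb{P}_\varepsilon(E)<\infty$, the distinct $\varepsilon$-connected components form a countable collection $\{E^{x_i}\}_{i\in I}$ of sets of positive measure whose union is $E^{(1)}$ and which satisfy $\mathbb{P}_\varepsilon(E)=\sum_{i\in I}\mathbb{P}_\varepsilon(E^{x_i})$; this is the collection meant in the claim.
   Formalization: The constant may also depend on ε (one independent of ε, as c(α,d,g) suggests, is impossible), and E is assumed to have energy P_ε(E)+∫_E g different from −∞, since otherwise minimizers with arbitrarily small components exist. *)

theory Defs
  imports "HOL-Analysis.Analysis"
begin

definition rho_frac :: "real \<Rightarrow> real \<Rightarrow> 'a::euclidean_space \<Rightarrow> real" where
  "rho_frac \<alpha> \<epsilon> z =
     indicator {0..\<epsilon>} (norm z) * norm z powr (- (real DIM('a) + \<alpha> - 1))"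

text \<open>On the diagonal \<open>x = y\<close> the numerator below vanishes, so the totalised values of
  division and of \<open>powr\<close> at \<open>0\<close> play no role.\<close>

definition nonlocal_perimeter ::
    "('a::euclidean_space \<Rightarrow> real) \<Rightarrow> 'a set \<Rightarrow> ennreal" where
  "nonlocal_perimeter \<rho> F =
     (\<integral>\<^sup>+ y. \<integral>\<^sup>+ x.
        ennreal (\<bar>indicator F x - indicator F y\<bar> / norm (x - y) * \<rho> (x - y))
      \<partial>lebesgue \<partial>lebesgue)"

definition Lp_function :: "real \<Rightarrow> ('a::euclidean_space \<Rightarrow> real) \<Rightarrow> bool" where
  "Lp_function p g \<longleftrightarrow>
     g \<in> borel_measurable lebesgue \<and> integrable lebesgue (\<lambda>x. \<bar>g x\<bar> powr p)"

text \<open>The Lebesgue integral with values in the extended reals.  The Bochner integral would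
  return \<open>0\<close> on sets over which \<open>g\<close> is not integrable; such sets of infinite measure can
  occur, since \<open>g\<close> is only assumed to lie in some \<open>L\<^sup>p\<close>.\<close>

definition set_integral_ereal :: "('a::euclidean_space \<Rightarrow> real) \<Rightarrow> 'a set \<Rightarrow> ereal" where
  "set_integral_ereal g F =
     enn2ereal (\<integral>\<^sup>+x\<in>F. ennreal (g x) \<partial>lebesgue)
     - enn2ereal (\<integral>\<^sup>+x\<in>F. ennreal (- g x) \<partial>lebesgue)"

text \<open>Since \<open>\<infinity> - \<infinity> = \<infinity>\<close> in type \<open>ereal\<close>, a set for which the integral or the sum is
  undefined gets energy \<open>\<infinity>\<close>, i.e. it is not a competitor for a minimum.\<close>

definition energy ::
    "real \<Rightarrow> real \<Rightarrow> ('a::euclidean_space \<Rightarrow> real) \<Rightarrow> 'a set \<Rightarrow> ereal" where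
  "energy \<alpha> \<epsilon> g F =
     enn2ereal (nonlocal_perimeter (rho_frac \<alpha> \<epsilon>) F) + set_integral_ereal g F"

definition density_one :: "'a::euclidean_space set \<Rightarrow> 'a set" where
  "density_one E =
     {x. ((\<lambda>r. measure lebesgue (E \<inter> ball x r) / measure lebesgue (ball x r)) \<longlongrightarrow> 1)
         (at_right 0)}"

definition eps_connected :: "real \<Rightarrow> 'a::euclidean_space set \<Rightarrow> 'a \<Rightarrow> 'a \<Rightarrow> bool" where
  "eps_connected \<epsilon> E x y \<longleftrightarrow>
     (\<exists>(N::nat) z. z 0 = x \<and> z N = y \<and> (\<forall>i\<le>N. z i \<in> density_one E) \<and>
        (\<forall>i<N. norm (z i - z (Suc i)) < \<epsilon>))"

definition eps_component :: "real \<Rightarrow> 'a::euclidean_space set \<Rightarrow> 'a \<Rightarrow> 'a set" where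
  "eps_component \<epsilon> E x = {y \<in> density_one E. eps_connected \<epsilon> E x y}"

definition eps_components :: "real \<Rightarrow> 'a::euclidean_space set \<Rightarrow> 'a set set" where
  "eps_components \<epsilon> E = eps_component \<epsilon> E ` density_one E"

end

theory Submission
  imports Defs
begin

text \<open>
  Write \<open>d\<close> for the dimension.  Let \<open>E\<close> be a minimizer of finite energy and \<open>C\<close> one of its
  components.  Two points of \<open>density_one E\<close>, one in \<open>C\<close> and one outside, are at distance at
  least \<open>\<epsilon>\<close>, so \<open>C\<close> and the rest of \<open>E\<close> interact only on the null set of pairs at distance
  exactly \<open>\<epsilon>\<close>.  Hence the perimeter is additive over this decomposition, and comparing the
  minimizer with \<open>E\<close> deprived of \<open>C\<close> yields \<open>P(C) \<le> \<integral>\<^sub>C g\<^sup>-\<close>, where \<open>P\<close> is the nonlocal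
  perimeter and \<open>g\<^sup>-\<close> the negative part of \<open>g\<close> (lemma \<open>minimizer_component_bound\<close>).

  This is impossible when \<open>|C|\<close> is small.  On the one hand, if \<open>B\<close> is a ball of twice the volume
  of \<open>C\<close> and radius \<open>R \<le> \<epsilon>\<close> around a point of \<open>C\<close>, then at least \<open>|C|\<close> of \<open>B\<close> lies
  outside \<open>C\<close>, at a distance where the kernel is at least \<open>R powr - (d + \<alpha>)\<close>.  Integrating
  over \<open>C\<close> gives \<open>P(C) \<ge> c |C| powr (1 - \<alpha>/d)\<close> (\<open>nonlocal_isoperimetric_inequality\<close>).  On the
  other hand, since \<open>g\<close> lies in \<open>L\<^sup>p\<close> with \<open>p = d/\<alpha>\<close>, a Hoelder-type estimate applied to the
  part of \<open>|g| powr p\<close> above a high level shows that \<open>\<integral>\<^sub>C |g|\<close> is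
  \<open>o(|C| powr (1 - 1/p))\<close> as \<open>|C|\<close> tends to \<open>0\<close> (\<open>Lp_function_small_sets\<close>).  The two
  exponents agree, which is the reason for the choice of \<open>p\<close>.

  Both arguments need \<open>C\<close> to be a measurable set of positive measure.  This rests on the Lebesgue
  density theorem, obtained here from the Vitali covering theorem: \<open>E\<close> and \<open>density_one E\<close> differ
  by a null set, and \<open>C\<close> is relatively open in \<open>density_one E\<close>.
\<close>

section \<open>The Lebesgue density theorem\<close>

lemma measure_lebesgue_ball_pos: "0 < r \<Longrightarrow> 0 < measure lebesgue (ball (x::'a::euclidean_space) r)"
  by simp

text \<open>Rewriting \<open>lebesgue\<close> to \<open>lborel\<close> on Borel sets only would leave balls and general
  measurable sets measured by different measures within one goal.\<close>
declare measure_completion [simp del] emeasure_completion [simp del]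

text \<open>Cover \<open>T\<close>, up to a null set, by disjoint balls, each with a fraction at least \<open>e\<close> of its volume
  outside \<open>E\<close> and all contained in an open superset \<open>U\<close> of \<open>E\<close>.  Their total volume is then at most
  \<open>|U - E| / e\<close>, which is arbitrarily small.  Estimating a cover of \<open>T\<close> in this way avoids any
  discussion of the measurability of \<open>T\<close>.\<close>
lemma negligible_thin_points:
  fixes E :: "'a::euclidean_space set"
  assumes E: "E \<in> sets lebesgue" and e: "0 < e"
  defines "T \<equiv> {x \<in> E. \<forall>\<rho>>0. \<exists>r. 0 < r \<and> r < \<rho> \<and>
                  e * measure lebesgue (ball x r) \<le> measure lebesgue (ball x r - E)}"
  shows "negligible T"
  unfolding negligible_outer_le
proof (intro allI impI)
  fix \<eta> :: real assume "\<eta> > 0"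
  then have "e * \<eta> > 0" using e by simp
  then obtain U where U: "open U" "E \<subseteq> U" "U - E \<in> lmeasurable"
      "emeasure lebesgue (U - E) < ennreal (e * \<eta>)"
    using sets_lebesgue_outer_open[OF E] by metis
  define K where "K = {i::'a \<times> real. 0 < snd i \<and> ball (fst i) (snd i) \<subseteq> U \<and>
     e * measure lebesgue (ball (fst i) (snd i)) \<le> measure lebesgue (ball (fst i) (snd i) - E)}"
  have "\<exists>i. i \<in> K \<and> x \<in> ball (fst i) (snd i) \<and> snd i < d" if x: "x \<in> T" and d: "0 < d" for x d
  proof -
    have "x \<in> U" using x U(2) by (auto simp: T_def)
    then obtain k where k: "k > 0" "ball x k \<subseteq> U" using U(1) openE by blast
    have "0 < min d k" using d k by simp
    then obtain r where r: "0 < r" "r < min d k"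
      "e * measure lebesgue (ball x r) \<le> measure lebesgue (ball x r - E)"
      using x unfolding T_def by blast
    have "ball x r \<subseteq> U" using k r subset_ball[of r k x] by auto
    then have "(x, r) \<in> K" using r by (auto simp: K_def)
    then show ?thesis using r by force
  qed
  then obtain D where D: "countable D" "D \<subseteq> K"
     "pairwise (\<lambda>i j. disjnt (ball (fst i) (snd i)) (ball (fst j) (snd j))) D"
     "negligible (T - (\<Union>i\<in>D. ball (fst i) (snd i)))"
    by (rule Vitali_covering_theorem_balls[of T K fst snd]) blast+
  let ?B = "\<lambda>i. ball (fst i) (snd i) :: 'a set"
  let ?N = "T - (\<Union>i\<in>D. ?B i)"
  have disj: "disjoint_family_on ?B D"
    using D(3) unfolding disjoint_family_on_def pairwise_def disjnt_def by blast
  then have disj': "disjoint_family_on (\<lambda>i. ?B i - E) D"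
    unfolding disjoint_family_on_def by blast
  have *: "ennreal e * emeasure lebesgue (?B i) \<le> emeasure lebesgue (?B i - E)" if "i \<in> D" for i
  proof -
    have "?B i \<in> lmeasurable" by simp
    moreover then have "?B i - E \<in> lmeasurable"
      using E fmeasurable_Diff by blast
    moreover have "e * measure lebesgue (?B i) \<le> measure lebesgue (?B i - E)"
      using that D(2) by (auto simp: K_def)
    ultimately show ?thesis
      using e by (simp add: emeasure_eq_measure2 ennreal_leI flip: ennreal_mult')
  qed
  have "ennreal e * emeasure lebesgue (\<Union>i\<in>D. ?B i)
      = (\<integral>\<^sup>+i. ennreal e * emeasure lebesgue (?B i) \<partial>count_space D)"
    using D(1) disj by (subst emeasure_UN_countable) (auto simp: nn_integral_cmult)
  also have "\<dots> \<le> (\<integral>\<^sup>+i. emeasure lebesgue (?B i - E) \<partial>count_space D)"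
    using * by (intro nn_integral_mono) auto
  also have "\<dots> = emeasure lebesgue (\<Union>i\<in>D. ?B i - E)"
    using D(1) disj' E by (subst emeasure_UN_countable) auto
  also have "\<dots> \<le> emeasure lebesgue (U - E)"
    using D(2) U E by (intro emeasure_mono) (auto simp: K_def)
  also have "\<dots> < ennreal e * ennreal \<eta>"
    using U(4) e \<open>\<eta> > 0\<close> by (simp add: ennreal_mult)
  finally have "emeasure lebesgue (\<Union>i\<in>D. ?B i) \<le> ennreal \<eta>"
    using mult_left_mono[of "ennreal \<eta>" "emeasure lebesgue (\<Union>i\<in>D. ?B i)" "ennreal e"]
    by (meson linear not_less zero_le)
  moreover have Dm: "(\<Union>i\<in>D. ?B i) \<in> sets lebesgue" using D(1) by (intro sets.countable_UN'') auto
  moreover have N: "?N \<in> null_sets lebesgue" using D(4) by (simp add: negligible_iff_null_sets)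
  ultimately have le: "emeasure lebesgue ((\<Union>i\<in>D. ?B i) \<union> ?N) \<le> ennreal \<eta>"
    by (simp only: emeasure_Un_null_set)
  have "(\<Union>i\<in>D. ?B i) \<union> ?N \<in> lmeasurable"
    using le by (intro fmeasurableI sets.Un[OF Dm null_setsD2[OF N]]) (auto intro: le_less_trans)
  moreover then have "measure lebesgue ((\<Union>i\<in>D. ?B i) \<union> ?N) \<le> \<eta>"
    using le \<open>\<eta> > 0\<close> by (simp add: emeasure_eq_measure2)
  ultimately show "\<exists>V. T \<subseteq> V \<and> V \<in> lmeasurable \<and> measure lebesgue V \<le> \<eta>"
    by (intro exI[of _ "(\<Union>i\<in>D. ?B i) \<union> ?N"]) auto
qed

lemma density_quotient_complement:
  fixes E :: "'a::euclidean_space set"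
  assumes E: "E \<in> sets lebesgue" and r: "0 < r"
  shows "measure lebesgue (E \<inter> ball x r) / measure lebesgue (ball x r)
       = 1 - measure lebesgue (ball x r - E) / measure lebesgue (ball x r)"
proof -
  have b: "ball x r \<in> lmeasurable" by simp
  have "ball x r - E = ball x r - E \<inter> ball x r" by blast
  moreover have "E \<inter> ball x r \<in> lmeasurable"
    using fmeasurable_Int_fmeasurable[OF b E] by (simp add: Int_commute)
  ultimately have "measure lebesgue (ball x r - E)
      = measure lebesgue (ball x r) - measure lebesgue (E \<inter> ball x r)"
    using b by (simp add: measurable_measure_Diff fmeasurableD)
  moreover have "measure lebesgue (ball x r) > 0" using measure_lebesgue_ball_pos[OF r] .
  ultimately show ?thesis by (simp add: field_simps Int_commute)
qed

text \<open>Density one of \<open>E\<close> is expressed through the part of the ball outside \<open>E\<close>, so that its failure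
  has the form treated by \<open>negligible_thin_points\<close>.\<close>
lemma density_one_iff_complement:
  fixes E :: "'a::euclidean_space set"
  assumes E: "E \<in> sets lebesgue"
  shows "x \<in> density_one E \<longleftrightarrow>
    ((\<lambda>r. measure lebesgue (ball x r - E) / measure lebesgue (ball x r)) \<longlongrightarrow> 0) (at_right 0)"
    (is "_ \<longleftrightarrow> (?q \<longlongrightarrow> 0) _")
proof -
  have "x \<in> density_one E \<longleftrightarrow> ((\<lambda>r. 1 - ?q r) \<longlongrightarrow> 1) (at_right 0)"
    unfolding density_one_def mem_Collect_eq
    by (intro filterlim_cong refl eventually_at_rightI[of 0 1])
       (auto simp: density_quotient_complement[OF E])
  also have "\<dots> \<longleftrightarrow> (?q \<longlongrightarrow> 0) (at_right 0)"
    using tendsto_diff[of "\<lambda>_. 1" 1 "at_right (0::real)" ?q 0]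
      tendsto_diff[of "\<lambda>_. 1" 1 "at_right (0::real)" "\<lambda>r. 1 - ?q r" 1] by auto
  finally show ?thesis .
qed

theorem negligible_Diff_density_one:
  fixes E :: "'a::euclidean_space set"
  assumes E: "E \<in> sets lebesgue"
  shows "negligible (E - density_one E)"
proof -
  \<comment> \<open>the exceptional set is a countable union over the thresholds \<open>1/(n+1)\<close>\<close>
  define T where "T n = {x \<in> E. \<forall>\<rho>>0. \<exists>r. 0 < r \<and> r < \<rho> \<and>
      inverse (Suc n) * measure lebesgue (ball x r) \<le> measure lebesgue (ball x r - E)}" for n
  have "negligible (T n)" for n
    unfolding T_def by (rule negligible_thin_points[OF E]) simp
  then have "negligible (\<Union>n. T n)" by (intro negligible_countable_Union) auto
  moreover have "E - density_one E \<subseteq> (\<Union>n. T n)"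
  proof
    fix x assume x: "x \<in> E - density_one E"
    show "x \<in> (\<Union>n. T n)"
    proof (rule ccontr)
      assume nT: "x \<notin> (\<Union>n. T n)"
      have "((\<lambda>r. measure lebesgue (ball x r - E) / measure lebesgue (ball x r)) \<longlongrightarrow> 0) (at_right 0)"
      proof (rule order_tendstoI)
        fix a :: real assume "a < 0"
        then show "\<forall>\<^sub>F r in at_right 0. a < measure lebesgue (ball x r - E) / measure lebesgue (ball x r)"
          by (auto intro!: always_eventually less_le_trans[of a 0])
      next
        fix a :: real assume "0 < a"
        then obtain n where n: "inverse (real (Suc n)) < a" using reals_Archimedean by blast
        obtain \<rho> where \<rho>: "\<rho> > 0" "\<And>r. 0 < r \<Longrightarrow> r < \<rho> \<Longrightarrow>
          measure lebesgue (ball x r - E) < inverse (Suc n) * measure lebesgue (ball x r)"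
          using nT x unfolding T_def by (simp add: not_le) blast
        have "measure lebesgue (ball x r - E) / measure lebesgue (ball x r) < a"
          if "0 < r" "r < \<rho>" for r
        proof -
          have "measure lebesgue (ball x r) > 0" using measure_lebesgue_ball_pos[OF that(1)] .
          then have "measure lebesgue (ball x r - E) / measure lebesgue (ball x r) < inverse (Suc n)"
            using \<rho>(2)[OF that] by (simp add: pos_divide_less_eq)
          then show ?thesis using n by simp
        qed
        then show "\<forall>\<^sub>F r in at_right 0. measure lebesgue (ball x r - E) / measure lebesgue (ball x r) < a"
          using \<rho>(1) by (intro eventually_at_rightI[of 0 \<rho>]) auto
      qed
      then show False using x density_one_iff_complement[OF E] by blast
    qed
  qed
  ultimately show ?thesis using negligible_subset by blast
qed

lemma density_one_disjoint_complement:
  fixes E :: "'a::euclidean_space set"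
  assumes E: "E \<in> sets lebesgue"
  shows "density_one E \<inter> density_one (- E) = {}"
proof (rule ccontr)
  assume "density_one E \<inter> density_one (- E) \<noteq> {}"
  then obtain x where x: "x \<in> density_one E" "x \<in> density_one (- E)" by blast
  have "((\<lambda>r. measure lebesgue (ball x r - E) / measure lebesgue (ball x r)) \<longlongrightarrow> 0) (at_right 0)"
    using x(1) density_one_iff_complement[OF E] by blast
  moreover have "((\<lambda>r. measure lebesgue (ball x r - E) / measure lebesgue (ball x r)) \<longlongrightarrow> 1) (at_right 0)"
    using x(2) unfolding density_one_def by (simp add: Diff_eq Int_commute)
  ultimately have "0 = (1::real)" by (rule tendsto_unique[OF trivial_limit_at_right_real])
  then show False by simp
qed

text \<open>Almost every point of the complement is a density point of the complement, hence not one
  of \<open>E\<close>.\<close>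
lemma negligible_density_one_Diff:
  fixes E :: "'a::euclidean_space set"
  assumes E: "E \<in> sets lebesgue"
  shows "negligible (density_one E - E)"
proof -
  have "- E \<in> sets lebesgue" using E by (metis Compl_in_sets_lebesgue)
  then have "negligible (- E - density_one (- E))" by (rule negligible_Diff_density_one)
  moreover have "density_one E - E \<subseteq> - E - density_one (- E)"
    using density_one_disjoint_complement[OF E] by blast
  ultimately show ?thesis using negligible_subset by blast
qed

lemma sets_density_one:
  fixes E :: "'a::euclidean_space set"
  assumes E: "E \<in> sets lebesgue"
  shows "density_one E \<in> sets lebesgue"
proof -
  have "density_one E = (E - (E - density_one E)) \<union> (density_one E - E)" by blast
  then show ?thesis
    using sets.Un[OF sets.Diff[OF E negligible_imp_sets[OF negligible_Diff_density_one[OF E]]]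
        negligible_imp_sets[OF negligible_density_one_Diff[OF E]]] by simp
qed

section \<open>Components of the set of density points\<close>

lemma eps_component_subset: "eps_component \<epsilon> E x \<subseteq> density_one E"
  by (auto simp: eps_component_def)

lemma self_in_eps_component: "x \<in> density_one E \<Longrightarrow> x \<in> eps_component \<epsilon> E x"
  unfolding eps_component_def eps_connected_def
  by (auto intro!: exI[of _ 0] exI[of _ "\<lambda>_. x"])

lemma eps_component_step:
  assumes y: "y \<in> eps_component \<epsilon> E x" and z: "z \<in> density_one E" "norm (y - z) < \<epsilon>"
  shows "z \<in> eps_component \<epsilon> E x"
proof -
  obtain N w where w: "w 0 = x" "w N = y" "\<forall>i\<le>(N::nat). w i \<in> density_one E"
      "\<forall>i<N. norm (w i - w (Suc i)) < \<epsilon>"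
    using y unfolding eps_component_def eps_connected_def by blast
  have "eps_connected \<epsilon> E x z"
    unfolding eps_connected_def
  proof (intro exI conjI)
    show "(w(Suc N := z)) 0 = x" "(w(Suc N := z)) (Suc N) = z"
      using w(1) by auto
    show "\<forall>i\<le>Suc N. (w(Suc N := z)) i \<in> density_one E"
      using w(3) z(1) by (simp add: le_Suc_eq)
    show "\<forall>i<Suc N. norm ((w(Suc N := z)) i - (w(Suc N := z)) (Suc i)) < \<epsilon>"
      using w(2,4) z(2) by (simp add: less_Suc_eq)
  qed
  then show ?thesis using z by (simp add: eps_component_def)
qed

text \<open>A component is relatively open in \<open>density_one E\<close>: it contains all density points within
  distance \<open>\<epsilon>\<close> of its members.\<close>
lemma sets_eps_component:
  fixes E :: "'a::euclidean_space set"
  assumes E: "E \<in> sets lebesgue" and "0 < \<epsilon>"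
  shows "eps_component \<epsilon> E x \<in> sets lebesgue"
proof -
  have "eps_component \<epsilon> E x = density_one E \<inter> (\<Union>y\<in>eps_component \<epsilon> E x. ball y \<epsilon>)"
    (is "?C = density_one E \<inter> ?U")
  proof
    show "?C \<subseteq> density_one E \<inter> ?U"
    proof
      fix y assume "y \<in> ?C"
      moreover have "y \<in> ball y \<epsilon>" using \<open>0 < \<epsilon>\<close> by simp
      ultimately show "y \<in> density_one E \<inter> ?U" using eps_component_subset by blast
    qed
    show "density_one E \<inter> ?U \<subseteq> ?C"
    proof
      fix z assume "z \<in> density_one E \<inter> ?U"
      then obtain y where "z \<in> density_one E" "y \<in> ?C" "norm (y - z) < \<epsilon>"
        by (auto simp: dist_norm)
      then show "z \<in> ?C" using eps_component_step by blast
    qed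
  qed
  moreover have "open (\<Union>y\<in>eps_component \<epsilon> E x. ball y \<epsilon>)" by blast
  then have "(\<Union>y\<in>eps_component \<epsilon> E x. ball y \<epsilon>) \<in> sets lebesgue"
    by (intro sets_completionI_sets) simp
  ultimately show ?thesis
    using sets.Int[OF sets_density_one[OF E]] by metis
qed

text \<open>Near a density point \<open>x\<close>, almost all of \<open>E\<close> consists of density points, and those within
  distance \<open>\<epsilon>\<close> of \<open>x\<close> belong to its component.  Were the component null, \<open>E\<close> would have density
  \<open>0\<close> at \<open>x\<close>.\<close>
lemma emeasure_eps_component_pos:
  fixes E :: "'a::euclidean_space set"
  assumes E: "E \<in> sets lebesgue" and \<epsilon>: "0 < \<epsilon>" and x: "x \<in> density_one E"
  shows "0 < emeasure lebesgue (eps_component \<epsilon> E x)"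
proof (rule ccontr)
  let ?C = "eps_component \<epsilon> E x"
  assume "\<not> 0 < emeasure lebesgue ?C"
  then have "?C \<in> null_sets lebesgue" using sets_eps_component[OF E \<epsilon>] by auto
  then have "negligible (?C \<union> (E - density_one E))"
    using negligible_Diff_density_one[OF E] by (simp add: negligible_iff_null_sets null_sets.Un)
  moreover have "E \<inter> ball x r \<subseteq> ?C \<union> (E - density_one E)" if "r \<le> \<epsilon>" for r
    using eps_component_step[OF self_in_eps_component[OF x]] that by (auto simp: dist_norm)
  ultimately have "measure lebesgue (E \<inter> ball x r) = 0" if "r \<le> \<epsilon>" for r
    using that by (intro negligible_imp_measure0) (blast intro: negligible_subset)
  then have "\<forall>\<^sub>F r in at_right 0. measure lebesgue (E \<inter> ball x r) / measure lebesgue (ball x r) = 0"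
    using \<epsilon> by (intro eventually_at_rightI[of 0 \<epsilon>]) auto
  then have "((\<lambda>r. measure lebesgue (E \<inter> ball x r) / measure lebesgue (ball x r)) \<longlongrightarrow> 0) (at_right 0)"
    by (rule tendsto_eventually)
  moreover have "((\<lambda>r. measure lebesgue (E \<inter> ball x r) / measure lebesgue (ball x r)) \<longlongrightarrow> 1) (at_right 0)"
    using x by (simp add: density_one_def)
  ultimately have "0 = (1::real)" by (rule tendsto_unique[OF trivial_limit_at_right_real])
  then show False by simp
qed

section \<open>The nonlocal perimeter\<close>

lemma sigma_finite_lebesgue: "sigma_finite_measure (lebesgue :: 'a::euclidean_space measure)"
proof
  show "\<exists>A::'a set set. countable A \<and> A \<subseteq> sets lebesgue \<and> \<Union> A = space lebesgue \<and>
      (\<forall>a\<in>A. emeasure lebesgue a \<noteq> \<infinity>)"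
  proof (intro exI[of _ "range (\<lambda>n. ball 0 (real n))"] conjI ballI)
    show "\<Union> (range (\<lambda>n. ball 0 (real n))) = space (lebesgue :: 'a measure)"
      using reals_Archimedean2 by (auto simp: dist_norm)
  next
    fix a :: "'a set" assume "a \<in> range (\<lambda>n. ball 0 (real n))"
    then have "a \<in> lmeasurable" by auto
    then show "emeasure lebesgue a \<noteq> \<infinity>" by (auto simp: fmeasurable_def)
  qed auto
qed

text \<open>The integrand of \<open>nonlocal_perimeter\<close>, named so that its joint measurability and the pointwise
  identities below can be stated without repeating the formula.\<close>
definition pair_energy :: "('a::euclidean_space \<Rightarrow> real) \<Rightarrow> 'a set \<Rightarrow> 'a \<Rightarrow> 'a \<Rightarrow> ennreal" where
  "pair_energy \<rho> F x y =
     ennreal (\<bar>indicator F x - indicator F y\<bar> / norm (x - y) * \<rho> (x - y))"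

lemma measurable_pair_energy:
  fixes \<rho> :: "'a::euclidean_space \<Rightarrow> real"
  assumes [measurable]: "\<rho> \<in> borel_measurable borel" and F [measurable]: "F \<in> sets lebesgue"
  shows "case_prod (\<lambda>y x. pair_energy \<rho> F x y) \<in> borel_measurable (lebesgue \<Otimes>\<^sub>M lebesgue)"
proof -
  have [measurable]: "(\<lambda>x. x) \<in> lebesgue \<rightarrow>\<^sub>M (borel :: 'a measure)"
    by (rule measurable_completion) simp
  have [measurable]: "fst \<in> lebesgue \<Otimes>\<^sub>M lebesgue \<rightarrow>\<^sub>M (borel :: 'a measure)"
      "snd \<in> lebesgue \<Otimes>\<^sub>M lebesgue \<rightarrow>\<^sub>M (borel :: 'a measure)"
    using measurable_compose[OF measurable_fst, of "\<lambda>x. x" lebesgue borel lebesgue]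
      measurable_compose[OF measurable_snd, of "\<lambda>x. x" lebesgue borel lebesgue] by (simp_all add: comp_def)
  show ?thesis
    unfolding pair_energy_def case_prod_beta by measurable
qed

text \<open>Separated sets do not interact.  For points closer than \<open>\<epsilon>\<close> at most one of the two pieces is
  visible, so the jumps of the indicators add up; beyond \<open>\<epsilon>\<close> the kernel vanishes; and distance
  exactly \<open>\<epsilon>\<close> is, for fixed \<open>y\<close>, a sphere of measure zero.  The null set \<open>N\<close> allows \<open>A\<close> and \<open>B\<close> to
  consist of density points of \<open>E\<close> instead of points of \<open>E\<close>.\<close>
lemma nonlocal_perimeter_split:
  fixes \<rho> :: "'a::euclidean_space \<Rightarrow> real"
  assumes \<rho>: "\<rho> \<in> borel_measurable borel" and "\<And>z. 0 \<le> \<rho> z" and range: "\<And>z. \<epsilon> < norm z \<Longrightarrow> \<rho> z = 0"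
    and E: "E \<in> sets lebesgue" and A: "A \<in> sets lebesgue" and B: "B \<in> sets lebesgue"
    and N: "negligible N" "\<And>x. x \<notin> N \<Longrightarrow> x \<in> E \<longleftrightarrow> x \<in> A \<union> B"
    and sep: "\<And>x y. x \<in> A \<Longrightarrow> y \<in> B \<Longrightarrow> \<epsilon> \<le> norm (x - y)" and disj: "A \<inter> B = {}"
  shows "nonlocal_perimeter \<rho> E = nonlocal_perimeter \<rho> A + nonlocal_perimeter \<rho> B"
proof -
  interpret sigma_finite_measure "lebesgue :: 'a measure" by (rule sigma_finite_lebesgue)
  note meas = measurable_pair_energy[OF \<rho>]
  have aeN: "AE x in lebesgue. x \<notin> N"
    using N(1) by (auto simp: negligible_iff_null_sets intro: AE_not_in)
  have split: "pair_energy \<rho> E x y = pair_energy \<rho> A x y + pair_energy \<rho> B x y"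
    if "x \<notin> N" "y \<notin> N" "x \<notin> sphere y \<epsilon>" for x y
  proof (cases "norm (x - y) < \<epsilon>")
    case True
    then have "\<not> (x \<in> A \<and> y \<in> B)" "\<not> (y \<in> A \<and> x \<in> B)"
      using sep by (force simp: norm_minus_commute)+
    then have "(indicator E x :: real) = indicator A x + indicator B x"
      "(indicator E y :: real) = indicator A y + indicator B y"
      "\<bar>(indicator A x + indicator B x) - (indicator A y + indicator B y)\<bar>
        = \<bar>indicator A x - indicator A y\<bar> + \<bar>indicator B x - indicator B y :: real\<bar>"
      using N(2)[OF that(1)] N(2)[OF that(2)] disj by (auto simp: indicator_def)
    then have "\<bar>indicator E x - indicator E y\<bar>
        = \<bar>indicator A x - indicator A y\<bar> + \<bar>indicator B x - indicator B y :: real\<bar>" by simp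
    then show ?thesis
      using assms(2) unfolding pair_energy_def
      by (simp add: add_divide_distrib ring_distribs flip: ennreal_plus)
  next
    case False
    then have "\<epsilon> < norm (x - y)" using that(3) by (auto simp: dist_norm norm_minus_commute)
    then show ?thesis by (simp add: pair_energy_def range)
  qed
  have "nonlocal_perimeter \<rho> E = (\<integral>\<^sup>+y. \<integral>\<^sup>+x. pair_energy \<rho> E x y \<partial>lebesgue \<partial>lebesgue)"
    by (simp add: nonlocal_perimeter_def pair_energy_def)
  also have "\<dots> = (\<integral>\<^sup>+y. \<integral>\<^sup>+x. pair_energy \<rho> A x y + pair_energy \<rho> B x y \<partial>lebesgue \<partial>lebesgue)"
  proof (rule nn_integral_cong_AE)
    show "AE y in lebesgue. (\<integral>\<^sup>+x. pair_energy \<rho> E x y \<partial>lebesgue)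
        = (\<integral>\<^sup>+x. pair_energy \<rho> A x y + pair_energy \<rho> B x y \<partial>lebesgue)"
      using aeN
    proof eventually_elim
      case (elim y)
      have "AE x in lebesgue. x \<notin> sphere y \<epsilon>"
        using negligible_sphere by (intro AE_not_in) (simp add: negligible_iff_null_sets)
      then have "AE x in lebesgue. pair_energy \<rho> E x y = pair_energy \<rho> A x y + pair_energy \<rho> B x y"
        using aeN by eventually_elim (use elim split in blast)
      then show ?case by (rule nn_integral_cong_AE)
    qed
  qed
  also have "\<dots> = (\<integral>\<^sup>+y. (\<integral>\<^sup>+x. pair_energy \<rho> A x y \<partial>lebesgue) + (\<integral>\<^sup>+x. pair_energy \<rho> B x y \<partial>lebesgue) \<partial>lebesgue)"
    using measurable_Pair2[OF meas[OF A]] measurable_Pair2[OF meas[OF B]]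
    by (intro nn_integral_cong nn_integral_add) auto
  also have "\<dots> = (\<integral>\<^sup>+y. \<integral>\<^sup>+x. pair_energy \<rho> A x y \<partial>lebesgue \<partial>lebesgue) + (\<integral>\<^sup>+y. \<integral>\<^sup>+x. pair_energy \<rho> B x y \<partial>lebesgue \<partial>lebesgue)"
    using borel_measurable_nn_integral[OF meas[OF A]] borel_measurable_nn_integral[OF meas[OF B]]
    by (intro nn_integral_add) auto
  finally show ?thesis by (simp add: nonlocal_perimeter_def pair_energy_def)
qed

lemma rho_frac_nonneg: "0 \<le> rho_frac \<alpha> \<epsilon> z"
  by (simp add: rho_frac_def)

lemma rho_frac_eq_0: "\<epsilon> < norm z \<Longrightarrow> rho_frac \<alpha> \<epsilon> z = 0"
  by (simp add: rho_frac_def)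

lemma measurable_rho_frac: "rho_frac \<alpha> \<epsilon> \<in> borel_measurable (borel :: 'a::euclidean_space measure)"
  unfolding rho_frac_def[abs_def] by measurable

text \<open>Every ball of radius \<open>R\<close> around a point of \<open>C\<close> contains at least \<open>|C|\<close> of the complement, all
  of it at distance less than \<open>R\<close>, where the kernel is bounded below.\<close>
lemma nonlocal_perimeter_ball_bound:
  fixes C :: "'a::euclidean_space set"
  assumes C: "C \<in> lmeasurable" and \<alpha>: "0 < \<alpha>" and R: "0 < R" "R \<le> \<epsilon>"
    and vol: "2 * measure lebesgue C \<le> measure lebesgue (ball (0::'a) R)"
  shows "ennreal ((measure lebesgue C)\<^sup>2 * R powr - (real DIM('a) + \<alpha>))
      \<le> nonlocal_perimeter (rho_frac \<alpha> \<epsilon>) C"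
proof -
  let ?m = "measure lebesgue C" and ?k = "R powr - (real DIM('a) + \<alpha>)"
  have kernel: "ennreal ?k * indicator (ball y R - C) x \<le> pair_energy (rho_frac \<alpha> \<epsilon>) C x y"
    if y: "y \<in> C" for x y
  proof (cases "x \<in> ball y R - C")
    case True
    then have n: "0 < norm (x - y)" "norm (x - y) < R" using y
      by (auto simp: dist_norm norm_minus_commute)
    \<comment> \<open>the factor \<open>1 / |x - y|\<close> raises the exponent of \<open>\<rho>\<close> by one\<close>
    have "?k \<le> norm (x - y) powr - (real DIM('a) + \<alpha>)"
      using n \<alpha> by (intro powr_mono2') auto
    also have "\<dots> = 1 / norm (x - y) * norm (x - y) powr - (real DIM('a) + \<alpha> - 1)"
    proof -
      have "norm (x - y) powr - (real DIM('a) + \<alpha>)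
          = norm (x - y) powr (- 1 + - (real DIM('a) + \<alpha> - 1))" by simp
      also have "\<dots> = norm (x - y) powr (- 1) * norm (x - y) powr - (real DIM('a) + \<alpha> - 1)"
        by (rule powr_add)
      finally show ?thesis using n by (simp add: powr_minus_divide)
    qed
    finally show ?thesis
      using True y n R by (simp add: pair_energy_def rho_frac_def ennreal_leI)
  qed simp
  have C': "C \<in> sets lebesgue" using C by blast
  have ball: "ennreal ?m \<le> emeasure lebesgue (ball y R - C)" for y
  proof -
    have b: "ball y R \<in> lmeasurable" by simp
    have "measure lebesgue (ball y R) = measure lebesgue (ball (0::'a) R)"
      using measure_translation[of y "ball 0 R"] by simp
    moreover have "measure lebesgue (ball y R - C)
        = measure lebesgue (ball y R) - measure lebesgue (C \<inter> ball y R)"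
    proof -
      have "ball y R - C = ball y R - C \<inter> ball y R" by blast
      then show ?thesis
        using b C by (simp add: measurable_measure_Diff fmeasurable.Int fmeasurableD)
    qed
    moreover have "measure lebesgue (C \<inter> ball y R) \<le> ?m"
      using C b by (intro measure_mono_fmeasurable) (auto simp: fmeasurableD)
    ultimately have "?m \<le> measure lebesgue (ball y R - C)" using vol by simp
    moreover have "ball y R - C \<in> lmeasurable" using b C by (rule fmeasurable.Diff)
    ultimately show ?thesis by (simp add: emeasure_eq_measure2 ennreal_leI)
  qed
  have "ennreal (?m\<^sup>2 * ?k) = ennreal ?k * ennreal ?m * emeasure lebesgue C"
    using C by (simp add: emeasure_eq_measure2 power2_eq_square mult_ac flip: ennreal_mult)
  also have "\<dots> = (\<integral>\<^sup>+y. ennreal ?k * ennreal ?m * indicator C y \<partial>lebesgue)"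
    using C' by (simp add: nn_integral_cmult_indicator)
  also have "\<dots> \<le> (\<integral>\<^sup>+y. \<integral>\<^sup>+x. pair_energy (rho_frac \<alpha> \<epsilon>) C x y \<partial>lebesgue \<partial>lebesgue)"
  proof (intro nn_integral_mono)
    fix y
    show "ennreal ?k * ennreal ?m * indicator C y
        \<le> (\<integral>\<^sup>+x. pair_energy (rho_frac \<alpha> \<epsilon>) C x y \<partial>lebesgue)"
    proof (cases "y \<in> C")
      case True
      have "ennreal ?k * ennreal ?m \<le> ennreal ?k * emeasure lebesgue (ball y R - C)"
        using ball by (intro mult_left_mono) auto
      also have "\<dots> = (\<integral>\<^sup>+x. ennreal ?k * indicator (ball y R - C) x \<partial>lebesgue)"
        using C' by (subst nn_integral_cmult_indicator) auto
      also have "\<dots> \<le> (\<integral>\<^sup>+x. pair_energy (rho_frac \<alpha> \<epsilon>) C x y \<partial>lebesgue)"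
        using kernel[OF True] by (intro nn_integral_mono)
      finally show ?thesis using True by simp
    qed simp
  qed
  finally show ?thesis by (simp add: nonlocal_perimeter_def pair_energy_def)
qed

text \<open>The restriction to volumes below \<open>\<kappa>\<close> comes from the cutoff of the kernel at \<open>\<epsilon>\<close>: a ball with
  twice the volume of \<open>C\<close> must have radius at most \<open>\<epsilon>\<close>.\<close>
proposition nonlocal_isoperimetric_inequality:
  fixes \<alpha> \<epsilon> :: real
  assumes \<alpha>: "0 < \<alpha>" and \<epsilon>: "0 < \<epsilon>"
  obtains c \<kappa> :: real where "0 < c" "0 < \<kappa>"
    "\<And>C :: 'a::euclidean_space set. C \<in> lmeasurable \<Longrightarrow> 0 < measure lebesgue C \<Longrightarrow> measure lebesgue C \<le> \<kappa>
      \<Longrightarrow> ennreal (c * measure lebesgue C powr (1 - \<alpha> / DIM('a))) \<le> nonlocal_perimeter (rho_frac \<alpha> \<epsilon>) C"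
proof
  let ?d = "real DIM('a)"
  define \<omega> where "\<omega> = unit_ball_vol ?d"
  have \<omega>: "\<omega> > 0" by (simp add: \<omega>_def)
  define c where "c = (2 / \<omega>) powr - (1 + \<alpha> / ?d)"
  show "0 < c" using \<omega> by (simp add: c_def)
  show "0 < \<omega> * \<epsilon> ^ DIM('a) / 2" using \<omega> \<epsilon> by simp
  fix C :: "'a set"
  assume C: "C \<in> lmeasurable" "0 < measure lebesgue C" "measure lebesgue C \<le> \<omega> * \<epsilon> ^ DIM('a) / 2"
  let ?m = "measure lebesgue C"
  \<comment> \<open>the radius of a ball with volume \<open>2 |C|\<close>\<close>
  define R where "R = (2 * ?m / \<omega>) powr (1 / ?d)"
  have R0: "0 < R" using C(2) \<omega> by (simp add: R_def)
  have Rd: "R ^ DIM('a) = 2 * ?m / \<omega>"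
    using C(2) \<omega> by (simp add: R_def powr_power)
  have "R ^ DIM('a) \<le> \<epsilon> ^ DIM('a)"
    using C(3) \<omega> unfolding Rd by (simp add: field_simps)
  then have R\<epsilon>: "R \<le> \<epsilon>" using \<epsilon> by (simp add: power_mono_iff R0 less_imp_le)
  have "measure lebesgue (ball (0::'a) R) = 2 * ?m"
    using R0 \<omega> Rd by (simp add: measure_completion content_ball \<omega>_def[symmetric])
  then have "ennreal (?m\<^sup>2 * R powr - (?d + \<alpha>)) \<le> nonlocal_perimeter (rho_frac \<alpha> \<epsilon>) C"
    using nonlocal_perimeter_ball_bound[OF C(1) \<alpha> R0 R\<epsilon>] by simp
  moreover have "?m\<^sup>2 * R powr - (?d + \<alpha>) = c * ?m powr (1 - \<alpha> / ?d)"
  proof -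
    have "1 / ?d * - (?d + \<alpha>) = - (1 + \<alpha> / ?d)" by (simp add: field_simps)
    then have "R powr - (?d + \<alpha>) = (2 / \<omega> * ?m) powr - (1 + \<alpha> / ?d)"
      by (simp only: R_def powr_powr times_divide_eq_left)
    also have "\<dots> = c * ?m powr - (1 + \<alpha> / ?d)"
      using C(2) \<omega> powr_mult[of "2 / \<omega>" ?m "- (1 + \<alpha> / ?d)"] by (simp only: c_def)
    finally have "?m\<^sup>2 * R powr - (?d + \<alpha>) = c * (?m powr 2 * ?m powr - (1 + \<alpha> / ?d))"
      using C(2) by simp
    also have "\<dots> = c * ?m powr (1 - \<alpha> / ?d)"
      unfolding powr_add[symmetric] by simp
    finally show ?thesis .
  qed
  ultimately show "ennreal (c * ?m powr (1 - \<alpha> / DIM('a))) \<le> nonlocal_perimeter (rho_frac \<alpha> \<epsilon>) C"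
    by simp
qed

section \<open>Integrals of \<open>L\<^sup>p\<close> functions over small sets\<close>

text \<open>Above the level \<open>\<tau>\<close> the bound comes from \<open>t = t powr (1 - p) * t powr p\<close> and \<open>1 - p < 0\<close>.  The
  separate, lower truncation level \<open>l\<close> allows \<open>\<tau>\<close> to vary while the truncated function is
  kept fixed.\<close>
lemma truncation_bound:
  fixes t \<tau> p l :: real
  assumes "0 \<le> t" and "0 < l" "l \<le> \<tau>" and p: "1 < p"
  shows "t \<le> \<tau> + \<tau> powr (1 - p) * (if l < t then t powr p else 0)"
proof (cases "t \<le> \<tau>")
  case True
  moreover have "0 \<le> \<tau> powr (1 - p) * (if l < t then t powr p else 0)" by simp
  ultimately show ?thesis by linarith
next
  case False
  then have t: "0 < t" "\<tau> < t" "l < t" "0 < \<tau>" using assms by auto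
  have "t = t powr (1 - p) * t powr p"
    using t by (simp flip: powr_add)
  also have "\<dots> \<le> \<tau> powr (1 - p) * t powr p"
    using t p by (intro mult_right_mono powr_mono2') auto
  finally show ?thesis using t by simp
qed

lemma integral_truncation_tendsto_0:
  fixes f g :: "'a \<Rightarrow> real"
  assumes "integrable M f" and [measurable]: "g \<in> borel_measurable M"
  shows "(\<lambda>n. \<integral>x. (if real n < g x then f x else 0) \<partial>M) \<longlonglongrightarrow> 0"
proof -
  have [measurable]: "f \<in> borel_measurable M" using assms by simp
  have "(\<lambda>n. \<integral>x. (if real n < g x then f x else 0) \<partial>M) \<longlonglongrightarrow> (\<integral>x. 0 \<partial>M)"
  proof (rule integral_dominated_convergence[where w = "\<lambda>x. \<bar>f x\<bar>"])
    show "AE x in M. (\<lambda>n. if real n < g x then f x else 0) \<longlonglongrightarrow> 0"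
    proof (rule AE_I2)
      fix x
      obtain m where "g x < real m" using reals_Archimedean2 by blast
      then have "\<forall>\<^sub>F n in sequentially. (if real n < g x then f x else 0) = 0"
        by (intro eventually_sequentiallyI[of m]) auto
      then show "(\<lambda>n. if real n < g x then f x else 0) \<longlonglongrightarrow> 0" by (rule tendsto_eventually)
    qed
  qed (use assms in auto)
  then show ?thesis by simp
qed

text \<open>Hoelder's inequality would give the bound with the \<open>L\<^sup>p\<close> norm of \<open>g\<close> on \<open>C\<close> as the constant.
  Integrating \<open>truncation_bound\<close> over \<open>C\<close> with \<open>\<tau> = s |C| powr (- 1/p)\<close> balances the two terms
  and has the same scaling; since \<open>\<tau>\<close> exceeds any fixed level once \<open>|C|\<close> is small, only the
  tail of \<open>|g| powr p\<close> enters, and the constant can be made arbitrarily small.\<close>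
lemma Lp_function_small_sets:
  fixes g :: "'a::euclidean_space \<Rightarrow> real"
  assumes g: "Lp_function p g" and p: "1 < p" and c: "0 < c"
  obtains \<delta> :: real where "0 < \<delta>"
    "\<And>C. C \<in> lmeasurable \<Longrightarrow> 0 < measure lebesgue C \<Longrightarrow> measure lebesgue C \<le> \<delta> \<Longrightarrow>
      (\<integral>\<^sup>+x\<in>C. ennreal \<bar>g x\<bar> \<partial>lebesgue) < ennreal (c * measure lebesgue C powr (1 - 1 / p))"
proof -
  have [measurable]: "g \<in> borel_measurable lebesgue" and int: "integrable lebesgue (\<lambda>x. \<bar>g x\<bar> powr p)"
    using g by (auto simp: Lp_function_def)
  \<comment> \<open>each of the two terms of the truncation bound receives half of the constant\<close>
  define s where "s = c / 2"
  have s: "0 < s" using c by (simp add: s_def)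
  define h where "h n x = (if real n < \<bar>g x\<bar> then \<bar>g x\<bar> powr p else 0)" for n x
  have hmeas [measurable]: "h n \<in> borel_measurable lebesgue" for n
    unfolding h_def[abs_def] by measurable
  have "(\<lambda>n. \<integral>x. h n x \<partial>lebesgue) \<longlonglongrightarrow> 0"
    unfolding h_def by (rule integral_truncation_tendsto_0[OF int]) measurable
  then have "\<forall>\<^sub>F n in sequentially. (\<integral>x. h n x \<partial>lebesgue) < s powr p"
    using s by (intro order_tendstoD) auto
  moreover have "\<forall>\<^sub>F n in sequentially. 1 \<le> n" by (rule eventually_ge_at_top)
  ultimately have "\<forall>\<^sub>F n in sequentially. (\<integral>x. h n x \<partial>lebesgue) < s powr p \<and> 1 \<le> n"
    by eventually_elim blast
  then obtain n where n: "(\<integral>x. h n x \<partial>lebesgue) < s powr p" "1 \<le> n"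
    by (auto simp: eventually_sequentially)
  define J where "J = (\<integral>x. h n x \<partial>lebesgue)"
  have "integrable lebesgue (h n)"
    by (rule Bochner_Integration.integrable_bound[OF int]) (auto simp: h_def)
  then have J: "(\<integral>\<^sup>+x. ennreal (h n x) \<partial>lebesgue) = ennreal J"
    unfolding J_def by (rule nn_integral_eq_integral) (simp add: h_def)
  have J0: "0 \<le> J" unfolding J_def by (rule integral_nonneg_AE) (simp add: h_def)
  show thesis
  proof
    show "0 < (s / real n) powr p" using s n by simp
    fix C :: "'a set"
    assume C: "C \<in> lmeasurable" "0 < measure lebesgue C" "measure lebesgue C \<le> (s / real n) powr p"
    let ?m = "measure lebesgue C"
    define \<tau> where "\<tau> = s * ?m powr - (1 / p)"
    have \<tau>0: "0 < \<tau>" using s C by (simp add: \<tau>_def)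
    \<comment> \<open>the bound on \<open>|C|\<close> is chosen to make \<open>\<tau>\<close> exceed the truncation level\<close>
    have n\<tau>: "real n \<le> \<tau>"
    proof -
      have "?m powr (1 / p) \<le> ((s / real n) powr p) powr (1 / p)"
        using C p by (intro powr_mono2) auto
      then have "?m powr (1 / p) \<le> s / real n"
        using s n p by (simp add: powr_powr)
      then show ?thesis
        using C n by (simp add: \<tau>_def powr_minus field_simps)
    qed
    have Cm [measurable]: "C \<in> sets lebesgue" using C by blast
    have "(\<integral>\<^sup>+x\<in>C. ennreal \<bar>g x\<bar> \<partial>lebesgue)
        \<le> (\<integral>\<^sup>+x. ennreal \<tau> * indicator C x + ennreal (\<tau> powr (1 - p)) * ennreal (h n x) \<partial>lebesgue)"
    proof (intro nn_integral_mono)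
      fix x
      have "\<bar>g x\<bar> \<le> \<tau> + \<tau> powr (1 - p) * h n x"
        unfolding h_def using n n\<tau> p by (intro truncation_bound) auto
      then have "ennreal \<bar>g x\<bar> \<le> ennreal (\<tau> + \<tau> powr (1 - p) * h n x)" by (rule ennreal_leI)
      also have "\<dots> = ennreal \<tau> + ennreal (\<tau> powr (1 - p)) * ennreal (h n x)"
        using \<tau>0 by (simp add: ennreal_plus ennreal_mult h_def)
      finally show "ennreal \<bar>g x\<bar> * indicator C x
          \<le> ennreal \<tau> * indicator C x + ennreal (\<tau> powr (1 - p)) * ennreal (h n x)"
        by (auto simp: indicator_def)
    qed
    also have "\<dots> = ennreal \<tau> * emeasure lebesgue C + ennreal (\<tau> powr (1 - p)) * ennreal J"
      using J by (simp add: nn_integral_add nn_integral_cmult nn_integral_cmult_indicator)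
    also have "\<dots> = ennreal (\<tau> * ?m + \<tau> powr (1 - p) * J)"
      using C \<tau>0 J0 by (simp add: emeasure_eq_measure2 ennreal_plus ennreal_mult)
    also have "\<dots> < ennreal (c * ?m powr (1 - 1 / p))"
    proof (rule ennreal_lessI)
      have eq: "\<tau> * ?m = s * ?m powr (1 - 1 / p)"
      proof -
        have "?m powr - (1 / p) * ?m = ?m powr (- (1 / p) + 1)"
          unfolding powr_add using C(2) by simp
        then show ?thesis by (simp add: \<tau>_def)
      qed
      have "\<tau> powr (1 - p) * J < \<tau> powr (1 - p) * s powr p"
        using n(1) \<tau>0 by (simp add: J_def)
      also have "\<tau> powr (1 - p) * s powr p = s * ?m powr (1 - 1 / p)"
      proof -
        have "\<tau> powr (1 - p) = s powr (1 - p) * ?m powr (- (1 / p) * (1 - p))"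
          using s C(2) by (simp add: \<tau>_def powr_mult powr_powr)
        moreover have "- (1 / p) * (1 - p) = 1 - 1 / p" using p by (simp add: field_simps)
        moreover have "s powr (1 - p) * s powr p = s"
          using s by (simp flip: powr_add)
        ultimately show ?thesis by (simp add: mult_ac)
      qed
      finally have "\<tau> powr (1 - p) * J < s * ?m powr (1 - 1 / p)" .
      then show "\<tau> * ?m + \<tau> powr (1 - p) * J < c * ?m powr (1 - 1 / p)"
        unfolding eq by (simp add: s_def)
      show "0 < c * ?m powr (1 - 1 / p)" using c C(2) by simp
    qed
    finally show "(\<integral>\<^sup>+x\<in>C. ennreal \<bar>g x\<bar> \<partial>lebesgue) < ennreal (c * ?m powr (1 - 1 / p))" .
  qed
qed

section \<open>Comparison with a minimizer\<close>

lemma nn_integral_split_AE: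
  fixes f :: "'a::euclidean_space \<Rightarrow> ennreal"
  assumes "f \<in> borel_measurable lebesgue" "A \<in> sets lebesgue" "B \<in> sets lebesgue"
    and N: "negligible N" "\<And>x. x \<notin> N \<Longrightarrow> x \<in> E \<longleftrightarrow> x \<in> A \<union> B" and disj: "A \<inter> B = {}"
  shows "(\<integral>\<^sup>+x\<in>E. f x \<partial>lebesgue) = (\<integral>\<^sup>+x\<in>A. f x \<partial>lebesgue) + (\<integral>\<^sup>+x\<in>B. f x \<partial>lebesgue)"
proof -
  have "AE x in lebesgue. x \<notin> N"
    using N(1) by (intro AE_not_in) (simp add: negligible_iff_null_sets)
  then have "AE x in lebesgue. f x * indicator E x = f x * indicator A x + f x * indicator B x"
    by eventually_elim (use N(2) disj in \<open>auto simp: indicator_def\<close>)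
  then have "(\<integral>\<^sup>+x\<in>E. f x \<partial>lebesgue) = (\<integral>\<^sup>+x. f x * indicator A x + f x * indicator B x \<partial>lebesgue)"
    by (rule nn_integral_cong_AE)
  also have "\<dots> = (\<integral>\<^sup>+x\<in>A. f x \<partial>lebesgue) + (\<integral>\<^sup>+x\<in>B. f x \<partial>lebesgue)"
    using assms by (intro nn_integral_add) auto
  finally show ?thesis .
qed

text \<open>Finiteness of \<open>e\<close> forces each of the six quantities to be finite, since in the extended reals
  both \<open>\<infinity> - \<infinity>\<close> and \<open>\<infinity> + - \<infinity>\<close> equal \<open>\<infinity>\<close>.  The common terms can then be cancelled.  Here
  \<open>p\<close> stands for perimeters, and the indices \<open>1\<close> and \<open>2\<close> for the integrals of the positive and
  the negative part of \<open>g\<close>.\<close>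
lemma ennreal_energy_cancel:
  fixes pA pB a1 b1 a2 b2 :: ennreal
  defines "e \<equiv> enn2ereal (pA + pB) + (enn2ereal (a1 + b1) - enn2ereal (a2 + b2))"
  assumes fin: "e \<noteq> \<infinity>" "e \<noteq> - \<infinity>"
    and le: "e \<le> enn2ereal pB + (enn2ereal b1 - enn2ereal b2)"
  shows "pA \<le> a2"
proof -
  have "pA + pB \<noteq> top" "a1 + b1 \<noteq> top"
    using fin(1) unfolding e_def by auto
  moreover from this have "a2 + b2 \<noteq> top"
    using fin(2) unfolding e_def by (cases "pA + pB"; cases "a1 + b1") (auto simp: enn2ereal_ennreal)
  ultimately obtain qA qB r1 s1 r2 s2 where *:
    "pA = ennreal qA" "pB = ennreal qB" "a1 = ennreal r1" "b1 = ennreal s1" "a2 = ennreal r2" "b2 = ennreal s2"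
    "0 \<le> qA" "0 \<le> qB" "0 \<le> r1" "0 \<le> s1" "0 \<le> r2" "0 \<le> s2"
    by (cases pA; cases pB; cases a1; cases b1; cases a2; cases b2) auto
  then have "qA + qB + (r1 + s1 - (r2 + s2)) \<le> qB + (s1 - s2)"
    using le unfolding e_def by (simp add: enn2ereal_ennreal flip: ennreal_plus)
  then show ?thesis using * by (simp add: ennreal_leI)
qed

text \<open>The competitor is \<open>B\<close>: removing the piece \<open>A\<close> saves its perimeter and costs at most the integral
  of the negative part of \<open>g\<close> over it.\<close>
lemma minimizer_piece_bound:
  fixes g :: "'a::euclidean_space \<Rightarrow> real"
  assumes g: "g \<in> borel_measurable lebesgue"
    and min: "is_arg_min (energy \<alpha> \<epsilon> g) (\<lambda>F. F \<in> sets lebesgue) E"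
    and fin: "energy \<alpha> \<epsilon> g E \<noteq> - \<infinity>"
    and A: "A \<in> sets lebesgue" and B: "B \<in> sets lebesgue"
    and N: "negligible N" "\<And>x. x \<notin> N \<Longrightarrow> x \<in> E \<longleftrightarrow> x \<in> A \<union> B"
    and sep: "\<And>x y. x \<in> A \<Longrightarrow> y \<in> B \<Longrightarrow> \<epsilon> \<le> norm (x - y)" and disj: "A \<inter> B = {}"
  shows "nonlocal_perimeter (rho_frac \<alpha> \<epsilon>) A \<le> (\<integral>\<^sup>+x\<in>A. ennreal (- g x) \<partial>lebesgue)"
proof -
  have le: "energy \<alpha> \<epsilon> g E \<le> energy \<alpha> \<epsilon> g F" if "F \<in> sets lebesgue" for F
    using min that by (auto simp: is_arg_min_def not_less)
  \<comment> \<open>comparison with the empty set excludes the value \<open>\<infinity>\<close>\<close>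
  have "energy \<alpha> \<epsilon> g {} = 0"
    by (simp add: energy_def nonlocal_perimeter_def set_integral_ereal_def zero_ennreal.rep_eq)
  then have "energy \<alpha> \<epsilon> g E \<le> 0" using le[of "{}"] by simp
  then have fin': "energy \<alpha> \<epsilon> g E \<noteq> \<infinity>" by auto
  have E: "E \<in> sets lebesgue" using min by (simp add: is_arg_min_def)
  have perE: "nonlocal_perimeter (rho_frac \<alpha> \<epsilon>) E
      = nonlocal_perimeter (rho_frac \<alpha> \<epsilon>) A + nonlocal_perimeter (rho_frac \<alpha> \<epsilon>) B"
    by (rule nonlocal_perimeter_split[OF measurable_rho_frac rho_frac_nonneg rho_frac_eq_0 E A B N sep disj])
  have gE: "(\<integral>\<^sup>+x\<in>E. f x \<partial>lebesgue) = (\<integral>\<^sup>+x\<in>A. f x \<partial>lebesgue) + (\<integral>\<^sup>+x\<in>B. f x \<partial>lebesgue)"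
    if "f \<in> borel_measurable lebesgue" for f :: "'a \<Rightarrow> ennreal"
    by (rule nn_integral_split_AE[OF that A B N disj])
  have m: "(\<lambda>x. ennreal (g x)) \<in> borel_measurable lebesgue" "(\<lambda>x. ennreal (- g x)) \<in> borel_measurable lebesgue"
    using g by auto
  show ?thesis
    using fin fin' le[OF B] unfolding energy_def set_integral_ereal_def perE gE[OF m(1)] gE[OF m(2)]
    by (intro ennreal_energy_cancel) auto
qed

text \<open>The pieces are the component and the remaining density points, which are separated by the
  definition of a component and together exhaust \<open>E\<close> up to a null set.\<close>
lemma minimizer_component_bound:
  fixes g :: "'a::euclidean_space \<Rightarrow> real"
  assumes g: "g \<in> borel_measurable lebesgue" and \<epsilon>: "0 < \<epsilon>"
    and min: "is_arg_min (energy \<alpha> \<epsilon> g) (\<lambda>F. F \<in> sets lebesgue) E"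
    and fin: "energy \<alpha> \<epsilon> g E \<noteq> - \<infinity>"
  shows "nonlocal_perimeter (rho_frac \<alpha> \<epsilon>) (eps_component \<epsilon> E x)
    \<le> (\<integral>\<^sup>+y\<in>eps_component \<epsilon> E x. ennreal \<bar>g y\<bar> \<partial>lebesgue)"
proof -
  let ?C = "eps_component \<epsilon> E x"
  let ?B = "density_one E - ?C"
  let ?N = "(E - density_one E) \<union> (density_one E - E)"
  have E: "E \<in> sets lebesgue" using min by (simp add: is_arg_min_def)
  have C: "?C \<in> sets lebesgue" by (rule sets_eps_component[OF E \<epsilon>])
  have B: "?B \<in> sets lebesgue" using sets_density_one[OF E] C by (rule sets.Diff)
  have N: "negligible ?N"
    using negligible_Diff_density_one[OF E] negligible_density_one_Diff[OF E] by (rule negligible_Un)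
  have sep: "\<epsilon> \<le> norm (y - z)" if "y \<in> ?C" "z \<in> ?B" for y z
    using that eps_component_step[OF that(1), of z] by force
  have "nonlocal_perimeter (rho_frac \<alpha> \<epsilon>) ?C \<le> (\<integral>\<^sup>+y\<in>?C. ennreal (- g y) \<partial>lebesgue)"
    by (rule minimizer_piece_bound[OF g min fin C B N _ sep]) (use eps_component_subset in blast)+
  also have "\<dots> \<le> (\<integral>\<^sup>+y\<in>?C. ennreal \<bar>g y\<bar> \<partial>lebesgue)"
    by (intro nn_integral_mono mult_right_mono ennreal_leI) auto
  finally show ?thesis .
qed

section \<open>The lower bound on the volume of components\<close>

theorem proposition2p13:
  fixes \<alpha> \<epsilon> :: real and g :: "'a::euclidean_space \<Rightarrow> real"
  assumes "0 < \<alpha>" and "\<alpha> < 1" and "0 < \<epsilon>"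
    and "Lp_function (real DIM('a) / \<alpha>) g"
  shows "\<exists>c::real. 0 < c \<and>
    (\<forall>E. is_arg_min (energy \<alpha> \<epsilon> g) (\<lambda>F. F \<in> sets lebesgue) E
        \<and> energy \<alpha> \<epsilon> g E \<noteq> - \<infinity> \<longrightarrow>
      (\<forall>C\<in>eps_components \<epsilon> E. ennreal c < emeasure lebesgue C))"
proof -
  have "\<alpha> < real DIM('a)" using \<open>\<alpha> < 1\<close> DIM_ge_Suc0[where 'a='a] by linarith
  then have p: "1 < real DIM('a) / \<alpha>" using \<open>0 < \<alpha>\<close> by simp
  obtain c \<kappa> :: real where c: "0 < c" "0 < \<kappa>"
    "\<And>C :: 'a set. C \<in> lmeasurable \<Longrightarrow> 0 < measure lebesgue C \<Longrightarrow> measure lebesgue C \<le> \<kappa>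
      \<Longrightarrow> ennreal (c * measure lebesgue C powr (1 - \<alpha> / DIM('a))) \<le> nonlocal_perimeter (rho_frac \<alpha> \<epsilon>) C"
    using nonlocal_isoperimetric_inequality[OF \<open>0 < \<alpha>\<close> \<open>0 < \<epsilon>\<close>] by blast
  obtain \<delta> :: real where \<delta>: "0 < \<delta>"
    "\<And>C. C \<in> lmeasurable \<Longrightarrow> 0 < measure lebesgue C \<Longrightarrow> measure lebesgue C \<le> \<delta> \<Longrightarrow>
      (\<integral>\<^sup>+x\<in>C. ennreal \<bar>g x\<bar> \<partial>lebesgue) < ennreal (c * measure lebesgue C powr (1 - 1 / (DIM('a) / \<alpha>)))"
    using Lp_function_small_sets[OF assms(4) p c(1)] by blast
  have "ennreal (min \<kappa> \<delta>) < emeasure lebesgue C"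
    if min: "is_arg_min (energy \<alpha> \<epsilon> g) (\<lambda>F. F \<in> sets lebesgue) E"
      and fin: "energy \<alpha> \<epsilon> g E \<noteq> - \<infinity>" and C: "C \<in> eps_components \<epsilon> E" for E C
  proof (rule ccontr)
    assume "\<not> ennreal (min \<kappa> \<delta>) < emeasure lebesgue C"
    then have small: "emeasure lebesgue C \<le> ennreal (min \<kappa> \<delta>)" by simp
    obtain x where x: "x \<in> density_one E" "C = eps_component \<epsilon> E x"
      using C by (auto simp: eps_components_def)
    have E: "E \<in> sets lebesgue" using min by (simp add: is_arg_min_def)
    have pos: "0 < emeasure lebesgue C"
      unfolding x(2) by (rule emeasure_eps_component_pos[OF E \<open>0 < \<epsilon>\<close> x(1)])
    have lm: "C \<in> lmeasurable"
      using small sets_eps_component[OF E \<open>0 < \<epsilon>\<close>] unfolding x(2)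
      by (intro fmeasurableI) (auto intro: le_less_trans)
    have m: "0 < measure lebesgue C" "measure lebesgue C \<le> \<kappa>" "measure lebesgue C \<le> \<delta>"
      using pos small c(2) \<delta>(1) by (auto simp: emeasure_eq_measure2[OF lm])
    have "nonlocal_perimeter (rho_frac \<alpha> \<epsilon>) C \<le> (\<integral>\<^sup>+y\<in>C. ennreal \<bar>g y\<bar> \<partial>lebesgue)"
      using minimizer_component_bound[OF _ \<open>0 < \<epsilon>\<close> min fin] assms(4) unfolding x(2) Lp_function_def by blast
    also have "\<dots> < ennreal (c * measure lebesgue C powr (1 - \<alpha> / DIM('a)))"
      using \<delta>(2)[OF lm m(1,3)] by simp
    also have "\<dots> \<le> nonlocal_perimeter (rho_frac \<alpha> \<epsilon>) C" by (rule c(3)[OF lm m(1,2)])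
    finally show False by simp
  qed
  moreover have "0 < min \<kappa> \<delta>" using c(2) \<delta>(1) by simp
  ultimately show ?thesis by blast
qed

end
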